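(* Let $(A^+,A^-,b,\varphi,c)$ be a BF-MWSAT instance with $\varphi$ a continuous t-norm and $c\ge0$. Assume that the scalar sets $I_j$, $S'_{ij}$ and all subsequent set operations (intersections, emptiness tests, minima) are computed exactly, and that preprocessing uses only equivalence-preserving reductions. Then the clause-witness branch-and-bound procedure described in the context (with repeated forced-witness propagation, the greedy disjoint-witness packing bound, lower-point closure, and complete branching over $J_i(p)$) terminates, and it returns a globally optimal solution of the BF-MWSAT instance whenever the instance is feasible; otherwise it returns infeasibility.
   Context: A t-norm is a commutative, associative map $\varphi:[0,1]^2\to[0,1]$, non-decreasing in each argument, with $\varphi(1,z)=z$. BF-MWSAT: let $\mathcal{I}=\{1,\dots,m\}$ (rows) and $\mathcal{J}=\{1,\dots,n\}$ (variables). Given $A^\pm=(a^\pm_{ij})\in[0,1]^{m\times n}$, $b\in[0,1]^m$, a continuous t-norm $\varphi$ and $c\in\mathbb{R}_{\ge0}^n$, minimize $c^Tx$ over $x\in[0,1]^n$ subject to $\max_{j\in\mathcal{J}}q_{ij}(x_j)=b_i$ for all $i\in\mathcal{I}$, where $q_{ij}(z)=\max\{\varphi(a^+_{ij},z),\varphi(a^-_{ij},1-z)\}$. Scalar sets: $I_{ij}=\{z\in[0,1]:q_{ij}(z)\le b_i\}$, $S_{ij}=\{z\in[0,1]:q_{ij}(z)=b_i\}$, $I_j=\bigcap_{i\in\mathcal{I}}I_{ij}$, $S'_{ij}=S_{ij}\cap I_j$, $J_i=\{j\in\mathcal{J}:S'_{ij}\ne\varnothing\}$. Preprocessing: it removes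 rows and yields a set $\mathcal{A}\subseteq\mathcal{I}$ of active rows, while all $I_j$ and $S'_{ij}$ are kept as computed from the original instance. It is equivalence-preserving if the feasible vectors of the instance are exactly the $x$ with $x_j\in I_j$ for all $j\in\mathcal{J}$ such that for each $i\in\mathcal{A}$ there is $j\in J_i$ with $x_j\in S'_{ij}$. Nodes: a node is a partial witness assignment $p:R(p)\to\mathcal{J}$ with $R(p)\subseteq\mathcal{A}$ and $p(i)\in J_i$. Its domains are $D_j(p)=I_j\cap\bigcap_{i\in R(p),\,p(i)=j}S'_{ij}$. For $i\in\mathcal{A}\setminus R(p)$ put $J_i(p)=\{j\in J_i:D_j(p)\cap S'_{ij}\ne\varnothing\}$. When all domains are nonempty, put $\underline{x}_j(p)=\min D_j(p)$, $\mathrm{LB}_0(p)=\sum_{j}c_j\underline{x}_j(p)$, and $$\delta_i(p)=\min_{j\in J_i(p)}c_j\bigl[\min(D_j(p)\cap S'_{ij})-\min D_j(p)\bigr]$$ (with $\min\varnothing=+\infty$ for the outer minimum). The greedy packing $K_g(p)$ is obtained by processing the rows $i\in\mathcal{A}\setminus R(p)$ in non-increasing order of $\delta_i(p)$ (ties arbitrary) and inserting a row whenever its set $J_i(p)$ is disjoint from the sets $J_r(p)$ of all rows $r$ already selected. The greedy bound is $\mathrm{LB}_g(p)=\mathrm{LB}_0(p)+\sum_{i\in K_g(p)}\delta_i(p)$. Procedure: 1. Compute the scalar sets; if some $I_j=\varnothing$ or some $J_i=\varnothing$, return infeasible. 2. Preprocess to obtain $\mathcal{A}$. Set the incumbent value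 $z^*=+\infty$ and incumbent $x^*$ undefined. Put the root node ($R(p)=\varnothing$) into the search list. 3. While the list is nonempty, remove a node $p$ (any selection order) and do the following: (a) Propagation: while all $D_j(p)$ and $J_i(p)$ are nonempty and some $i\in\mathcal{A}\setminus R(p)$ has $J_i(p)=\{j\}$, extend $p$ by $p(i)=j$ and recompute domains and witness sets. (b) If some $D_j(p)$ is empty, or $J_i(p)$ is empty for some unassigned active $i$, discard the node. (c) If $\mathrm{LB}_0(p)\ge z^*$, discard the node. (d) Lower-point closure: if $\underline{x}(p)$ satisfies all original rows, set $(x^*,z^* )=(\underline{x}(p),\mathrm{LB}_0(p))$ and discard the node. (e) If $\mathrm{LB}_g(p)\ge z^*$, discard the node. (f) Branching: choose $i^*\in\mathcal{A}\setminus R(p)$ minimizing $|J_i(p)|$ (ties broken by larger $\delta_i(p)$, then arbitrarily). For every $j\in J_{i^*}(p)$, create the child extending $p$ by $p(i^* )=j$, and insert all children into the list, ordered by nondecreasing greedy bound. 4. Return $(x^*,z^* )$ if $x^*$ is defined; otherwise return infeasible. *)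

theory Defs
  imports "HOL-Analysis.Analysis"
begin

definition t_norm :: "(real \<Rightarrow> real \<Rightarrow> real) \<Rightarrow> bool" where
  "t_norm \<phi> \<longleftrightarrow>
     (\<forall>x\<in>{0..1}. \<forall>y\<in>{0..1}. \<phi> x y \<in> {0..1}) \<and>
     (\<forall>x\<in>{0..1}. \<forall>y\<in>{0..1}. \<phi> x y = \<phi> y x) \<and>
     (\<forall>x\<in>{0..1}. \<forall>y\<in>{0..1}. \<forall>z\<in>{0..1}. \<phi> (\<phi> x y) z = \<phi> x (\<phi> y z)) \<and>
     (\<forall>x\<in>{0..1}. \<forall>y\<in>{0..1}. \<forall>z\<in>{0..1}. x \<le> y \<longrightarrow> \<phi> x z \<le> \<phi> y z \<and> \<phi> z x \<le> \<phi> z y) \<and>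
     (\<forall>z\<in>{0..1}. \<phi> 1 z = z)"

definition continuous_t_norm :: "(real \<Rightarrow> real \<Rightarrow> real) \<Rightarrow> bool" where
  "continuous_t_norm \<phi> \<longleftrightarrow>
     t_norm \<phi> \<and> continuous_on ({0..1} \<times> {0..1}) (\<lambda>(x, y). \<phi> x y)"

record bf_mwsat =
  nrows :: nat
  nvars :: nat
  aplus :: "nat \<Rightarrow> nat \<Rightarrow> real"
  aminus :: "nat \<Rightarrow> nat \<Rightarrow> real"
  rhs :: "nat \<Rightarrow> real"
  tnorm :: "real \<Rightarrow> real \<Rightarrow> real"
  cost :: "nat \<Rightarrow> real"

definition Rows :: "bf_mwsat \<Rightarrow> nat set" where
  "Rows P = {1..nrows P}"

definition Vars :: "bf_mwsat \<Rightarrow> nat set" where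
  "Vars P = {1..nvars P}"

text \<open>At least one variable is required, so that the maximum over the variables in a row
  is defined.\<close>

definition bf_mwsat_instance :: "bf_mwsat \<Rightarrow> bool" where
  "bf_mwsat_instance P \<longleftrightarrow>
     1 \<le> nvars P \<and>
     (\<forall>i\<in>Rows P. \<forall>j\<in>Vars P. aplus P i j \<in> {0..1} \<and> aminus P i j \<in> {0..1}) \<and>
     (\<forall>i\<in>Rows P. rhs P i \<in> {0..1}) \<and>
     continuous_t_norm (tnorm P) \<and>
     (\<forall>j\<in>Vars P. 0 \<le> cost P j)"

definition q :: "bf_mwsat \<Rightarrow> nat \<Rightarrow> nat \<Rightarrow> real \<Rightarrow> real" where
  "q P i j z = max (tnorm P (aplus P i j) z) (tnorm P (aminus P i j) (1 - z))"

definition satisfies_rows :: "bf_mwsat \<Rightarrow> (nat \<Rightarrow> real) \<Rightarrow> bool" where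
  "satisfies_rows P x \<longleftrightarrow> (\<forall>i\<in>Rows P. Max ((\<lambda>j. q P i j (x j)) ` Vars P) = rhs P i)"

text \<open>Vectors are extensional functions on the variable indices, so that equality of
  functions is equality of vectors.\<close>

definition feasible :: "bf_mwsat \<Rightarrow> (nat \<Rightarrow> real) \<Rightarrow> bool" where
  "feasible P x \<longleftrightarrow> x \<in> Vars P \<rightarrow>\<^sub>E {0..1} \<and> satisfies_rows P x"

definition objective :: "bf_mwsat \<Rightarrow> (nat \<Rightarrow> real) \<Rightarrow> real" where
  "objective P x = (\<Sum>j\<in>Vars P. cost P j * x j)"

definition globally_optimal :: "bf_mwsat \<Rightarrow> (nat \<Rightarrow> real) \<Rightarrow> bool" where
  "globally_optimal P x \<longleftrightarrow>
     feasible P x \<and> (\<forall>y. feasible P y \<longrightarrow> objective P x \<le> objective P y)"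


subsection \<open>Scalar sets\<close>

definition Iset :: "bf_mwsat \<Rightarrow> nat \<Rightarrow> nat \<Rightarrow> real set" where
  "Iset P i j = {z \<in> {0..1}. q P i j z \<le> rhs P i}"

definition Sset :: "bf_mwsat \<Rightarrow> nat \<Rightarrow> nat \<Rightarrow> real set" where
  "Sset P i j = {z \<in> {0..1}. q P i j z = rhs P i}"

text \<open>Intersecting with the unit interval matters only if there are no rows.\<close>

definition Idom :: "bf_mwsat \<Rightarrow> nat \<Rightarrow> real set" where
  "Idom P j = {0..1} \<inter> (\<Inter>i\<in>Rows P. Iset P i j)"

definition S' :: "bf_mwsat \<Rightarrow> nat \<Rightarrow> nat \<Rightarrow> real set" where
  "S' P i j = Sset P i j \<inter> Idom P j"

definition Jset :: "bf_mwsat \<Rightarrow> nat \<Rightarrow> nat set" where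
  "Jset P i = {j \<in> Vars P. S' P i j \<noteq> {}}"

definition equivalence_preserving :: "bf_mwsat \<Rightarrow> nat set \<Rightarrow> bool" where
  "equivalence_preserving P A \<longleftrightarrow>
     A \<subseteq> Rows P \<and>
     {x. feasible P x} =
       {x \<in> Pi\<^sub>E (Vars P) (Idom P). \<forall>i\<in>A. \<exists>j\<in>Jset P i. x j \<in> S' P i j}"


subsection \<open>Nodes\<close>

text \<open>A node is a partial map from rows to variables; its set of assigned rows is its
  \<^const>\<open>dom\<close>. The steps below only create nodes assigning active rows \<open>i\<close> to elements
  of \<open>Jset P i\<close>, since \<open>Jnode P p i \<subseteq> Jset P i\<close>.\<close>

type_synonym node = "nat \<Rightarrow> nat option"

definition Dnode :: "bf_mwsat \<Rightarrow> node \<Rightarrow> nat \<Rightarrow> real set" where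
  "Dnode P p j = Idom P j \<inter> (\<Inter>i\<in>{i. p i = Some j}. S' P i j)"

definition Jnode :: "bf_mwsat \<Rightarrow> node \<Rightarrow> nat \<Rightarrow> nat set" where
  "Jnode P p i = {j \<in> Jset P i. Dnode P p j \<inter> S' P i j \<noteq> {}}"

definition min_of :: "real set \<Rightarrow> real" where
  "min_of D = (LEAST z. z \<in> D)"

definition lower_point :: "bf_mwsat \<Rightarrow> node \<Rightarrow> nat \<Rightarrow> real" where
  "lower_point P p = (\<lambda>j\<in>Vars P. min_of (Dnode P p j))"

definition LB0 :: "bf_mwsat \<Rightarrow> node \<Rightarrow> real" where
  "LB0 P p = (\<Sum>j\<in>Vars P. cost P j * lower_point P p j)"

definition delta :: "bf_mwsat \<Rightarrow> node \<Rightarrow> nat \<Rightarrow> ereal" where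
  "delta P p i =
     (if Jnode P p i = {} then \<infinity>
      else ereal (Min ((\<lambda>j. cost P j * (min_of (Dnode P p j \<inter> S' P i j) - min_of (Dnode P p j)))
                        ` Jnode P p i)))"

definition greedy_select :: "(nat \<Rightarrow> nat set) \<Rightarrow> nat list \<Rightarrow> nat set" where
  "greedy_select W rs =
     fold (\<lambda>i K. if \<forall>r\<in>K. W i \<inter> W r = {} then insert i K else K) rs {}"

text \<open>Ties in the processing order are arbitrary, so the greedy packing and the greedy bound
  are relations rather than functions.\<close>

definition greedy_packing :: "bf_mwsat \<Rightarrow> nat set \<Rightarrow> node \<Rightarrow> nat set \<Rightarrow> bool" where
  "greedy_packing P A p K \<longleftrightarrow>
     (\<exists>rs. distinct rs \<and> set rs = A - dom p \<and>
           sorted_wrt (\<lambda>i r. delta P p r \<le> delta P p i) rs \<and>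
           K = greedy_select (Jnode P p) rs)"

definition greedy_bound :: "bf_mwsat \<Rightarrow> nat set \<Rightarrow> node \<Rightarrow> ereal \<Rightarrow> bool" where
  "greedy_bound P A p L \<longleftrightarrow>
     (\<exists>K. greedy_packing P A p K \<and> L = ereal (LB0 P p) + (\<Sum>i\<in>K. delta P p i))"


subsection \<open>The branch-and-bound procedure\<close>

definition consistent :: "bf_mwsat \<Rightarrow> nat set \<Rightarrow> node \<Rightarrow> bool" where
  "consistent P A p \<longleftrightarrow>
     (\<forall>j\<in>Vars P. Dnode P p j \<noteq> {}) \<and> (\<forall>i\<in>A - dom p. Jnode P p i \<noteq> {})"

definition forced_extension :: "bf_mwsat \<Rightarrow> nat set \<Rightarrow> node \<Rightarrow> node \<Rightarrow> bool" where
  "forced_extension P A p p' \<longleftrightarrow>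
     consistent P A p \<and> (\<exists>i\<in>A - dom p. \<exists>j. Jnode P p i = {j} \<and> p' = p(i \<mapsto> j))"

definition propagated :: "bf_mwsat \<Rightarrow> nat set \<Rightarrow> node \<Rightarrow> bool" where
  "propagated P A p \<longleftrightarrow> (\<nexists>p'. forced_extension P A p p')"

definition branching_row :: "bf_mwsat \<Rightarrow> nat set \<Rightarrow> node \<Rightarrow> nat \<Rightarrow> bool" where
  "branching_row P A p i \<longleftrightarrow>
     i \<in> A - dom p \<and>
     (\<forall>r\<in>A - dom p. card (Jnode P p i) < card (Jnode P p r) \<or>
        card (Jnode P p i) = card (Jnode P p r) \<and> delta P p r \<le> delta P p i)"

definition children_list :: "bf_mwsat \<Rightarrow> nat set \<Rightarrow> node \<Rightarrow> nat \<Rightarrow> node list \<Rightarrow> bool" where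
  "children_list P A p i cs \<longleftrightarrow>
     distinct cs \<and> set cs = (\<lambda>j. p(i \<mapsto> j)) ` Jnode P p i \<and>
     (\<exists>B. (\<forall>c\<in>set cs. greedy_bound P A c (B c)) \<and> sorted (map B cs))"

datatype bb_result = Infeasible | Solution "nat \<Rightarrow> real" ereal

text \<open>\<open>Search L x z\<close> is the head of the main loop, \<open>Process p L x z\<close> the treatment of a removed
  node \<open>p\<close>; \<open>L\<close> is the search list and \<open>x\<close>, \<open>z\<close> are the incumbent and its value, where an
  undefined incumbent is \<^const>\<open>None\<close>.\<close>

datatype bb_state =
    Start
  | Search "node list" "(nat \<Rightarrow> real) option" ereal
  | Process node "node list" "(nat \<Rightarrow> real) option" ereal
  | Return bb_result

text \<open>The arbitrary choices of the procedure are nondeterministic: the node to be removed, the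
  propagated row, ties, and the positions at which the ordered children enter the list
  (\<^const>\<open>shuffles\<close>). One propagation is one step, so termination includes termination of
  the propagation loop.\<close>

inductive bb_step :: "bf_mwsat \<Rightarrow> nat set \<Rightarrow> bb_state \<Rightarrow> bb_state \<Rightarrow> bool"
  for P :: bf_mwsat and A :: "nat set" where
  reject:
    "(\<exists>j\<in>Vars P. Idom P j = {}) \<or> (\<exists>i\<in>Rows P. Jset P i = {}) \<Longrightarrow>
     bb_step P A Start (Return Infeasible)"
| initialize:
    "\<lbrakk>\<forall>j\<in>Vars P. Idom P j \<noteq> {}; \<forall>i\<in>Rows P. Jset P i \<noteq> {}\<rbrakk> \<Longrightarrow>
     bb_step P A Start (Search [Map.empty] None \<infinity>)"
| select:
    "bb_step P A (Search (L1 @ p # L2) x z) (Process p (L1 @ L2) x z)"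
| propagate:
    "forced_extension P A p p' \<Longrightarrow>
     bb_step P A (Process p L x z) (Process p' L x z)"
| discard_inconsistent:
    "\<lbrakk>propagated P A p; \<not> consistent P A p\<rbrakk> \<Longrightarrow>
     bb_step P A (Process p L x z) (Search L x z)"
| discard_LB0:
    "\<lbrakk>propagated P A p; consistent P A p; ereal (LB0 P p) \<ge> z\<rbrakk> \<Longrightarrow>
     bb_step P A (Process p L x z) (Search L x z)"
| lower_point_closure:
    "\<lbrakk>propagated P A p; consistent P A p; ereal (LB0 P p) < z;
      satisfies_rows P (lower_point P p)\<rbrakk> \<Longrightarrow>
     bb_step P A (Process p L x z) (Search L (Some (lower_point P p)) (ereal (LB0 P p)))"
| discard_greedy:
    "\<lbrakk>propagated P A p; consistent P A p; ereal (LB0 P p) < z;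
      \<not> satisfies_rows P (lower_point P p);
      greedy_bound P A p b; b \<ge> z\<rbrakk> \<Longrightarrow>
     bb_step P A (Process p L x z) (Search L x z)"
| branch:
    "\<lbrakk>propagated P A p; consistent P A p; ereal (LB0 P p) < z;
      \<not> satisfies_rows P (lower_point P p);
      greedy_bound P A p b; b < z;
      branching_row P A p i; children_list P A p i cs; L' \<in> shuffles L cs\<rbrakk> \<Longrightarrow>
     bb_step P A (Process p L x z) (Search L' x z)"
| return_incumbent:
    "bb_step P A (Search [] (Some x) z) (Return (Solution x z))"
| return_infeasible:
    "bb_step P A (Search [] None z) (Return Infeasible)"

end

theory Submission
  imports Defs
begin

text \<open>
  Call a feasible vector \<open>y\<close> a completion of a node \<open>p\<close> if \<open>y j\<close> lies in the domain
  \<open>Dnode P p j\<close> for every variable \<open>j\<close>. The procedure is correct because at every moment each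
  feasible vector either costs at least as much as the incumbent or is a completion of a node
  that is still open (\<open>search_inv\<close>). Four facts keep this true.

  \<^item> Under \<open>equivalence_preserving\<close>, a completion of \<open>p\<close> has, for every unassigned active row
    \<open>i\<close>, a witness in \<open>Jnode P p i\<close> (\<open>completion_witness\<close>). Hence propagation loses no
    completion, and the children of a branching cover all completions of their parent.
  \<^item> \<open>LB0\<close> bounds every completion from below, since each domain is compact and its minimum is
    attained (\<open>LB0_le_objective\<close>).
  \<^item> The greedy bound does too (\<open>greedy_bound_le_objective\<close>): the rows of the packing have disjoint
    witness sets, so their witnesses are different variables, and the increments that these
    variables must pay over their lower points add up.
  \<^item> A lower point that satisfies all rows is feasible with cost \<open>LB0\<close>; it is therefore a
    cheapest completion of its node, which may be closed.

  When the list is empty, the incumbent thus is optimal, and without an incumbent there is no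
  feasible vector. It remains to exclude that the procedure is stuck before it returns. The only
  doubtful point is whether a branching row exists. If every active row is assigned, the lower
  point lies in the set \<open>S'\<close> prescribed by each of them, so it is feasible by equivalence of the
  preprocessing and the node has been closed already (\<open>lower_point_feasible_if_all_assigned\<close>).

  Termination: each assignment decreases the number of unassigned active rows, and branching
  creates at most \<open>nvars P\<close> children. A weight exponential in that number therefore outweighs
  the weights of all children together, and the total weight of the open nodes decreases
  (\<open>bb_step_decreases\<close>).
\<close>

section \<open>Minima of compact sets and greedy packings\<close>

lemma min_of_compact:
  assumes "compact D" "D \<noteq> {}"
  shows min_of_in: "min_of D \<in> D"
    and min_of_le: "z \<in> D \<Longrightarrow> min_of D \<le> z"
proof -
  obtain m where m: "m \<in> D" "\<forall>z\<in>D. m \<le> z"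
    using compact_attains_inf[OF assms] by blast
  have "min_of D = m"
    unfolding min_of_def by (rule Least_equality) (use m in auto)
  then show "min_of D \<in> D" "z \<in> D \<Longrightarrow> min_of D \<le> z"
    using m by auto
qed

lemma greedy_select_subset: "greedy_select W rs \<subseteq> set rs"
  by (induction rs rule: rev_induct) (auto simp: greedy_select_def)

lemma greedy_select_disjoint:
  assumes "i \<in> greedy_select W rs" "r \<in> greedy_select W rs" "i \<noteq> r"
  shows "W i \<inter> W r = {}"
  using assms
  by (induction rs arbitrary: i r rule: rev_induct)
    (auto simp: greedy_select_def split: if_splits)

section \<open>Completions of nodes\<close>

definition valid_node :: "bf_mwsat \<Rightarrow> nat set \<Rightarrow> node \<Rightarrow> bool" where
  "valid_node P A p \<longleftrightarrow> (\<forall>i j. p i = Some j \<longrightarrow> i \<in> A \<and> j \<in> Jset P i)"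

definition node_completion :: "bf_mwsat \<Rightarrow> node \<Rightarrow> (nat \<Rightarrow> real) \<Rightarrow> bool" where
  "node_completion P p y \<longleftrightarrow> feasible P y \<and> (\<forall>j\<in>Vars P. y j \<in> Dnode P p j)"

lemma Jnode_subset_Vars: "Jnode P p i \<subseteq> Vars P"
  by (auto simp: Jnode_def Jset_def)

lemma finite_Vars [simp]: "finite (Vars P)"
  by (simp add: Vars_def)

lemma finite_Jnode [simp]: "finite (Jnode P p i)"
  by (rule finite_subset[OF Jnode_subset_Vars]) simp

lemma valid_node_update:
  assumes "valid_node P A p" "i \<in> A" "j \<in> Jnode P p i"
  shows "valid_node P A (p(i \<mapsto> j))"
  using assms by (auto simp: valid_node_def Jnode_def)

lemma completion_update:
  assumes "node_completion P p y" "y j \<in> S' P i j"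
  shows "node_completion P (p(i \<mapsto> j)) y"
  using assms by (auto simp: node_completion_def Dnode_def split: if_splits)

locale bf_mwsat_preprocessed =
  fixes P :: bf_mwsat and A :: "nat set"
  assumes instance_P: "bf_mwsat_instance P"
    and equiv: "equivalence_preserving P A"
begin

lemma A_subset_Rows: "A \<subseteq> Rows P"
  using equiv by (simp add: equivalence_preserving_def)

lemma finite_A [simp]: "finite A"
  using A_subset_Rows finite_subset by (auto simp: Rows_def)

lemma Vars_nonempty: "Vars P \<noteq> {}"
  using instance_P by (auto simp: bf_mwsat_instance_def Vars_def)

lemma cost_nonneg: "j \<in> Vars P \<Longrightarrow> 0 \<le> cost P j"
  using instance_P by (auto simp: bf_mwsat_instance_def)

lemma feasible_iff:
  "feasible P x \<longleftrightarrow>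
     x \<in> Pi\<^sub>E (Vars P) (Idom P) \<and> (\<forall>i\<in>A. \<exists>j\<in>Jset P i. x j \<in> S' P i j)"
  using equiv by (auto simp: equivalence_preserving_def set_eq_iff)

text \<open>A maximum is attained. This gives a witness for every original row, so an empty
  \<open>Jset P i\<close> refutes feasibility also when preprocessing has removed row \<open>i\<close>.\<close>

lemma feasible_witness:
  assumes "feasible P x" "i \<in> Rows P"
  shows "\<exists>j\<in>Jset P i. x j \<in> S' P i j"
proof -
  have "rhs P i \<in> (\<lambda>j. q P i j (x j)) ` Vars P"
    using assms Max_in[of "(\<lambda>j. q P i j (x j)) ` Vars P"] Vars_nonempty
    by (auto simp: feasible_def satisfies_rows_def)
  then obtain j where j: "j \<in> Vars P" "q P i j (x j) = rhs P i"
    by auto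
  have "x j \<in> Idom P j"
    using assms j by (auto simp: feasible_iff)
  moreover from this have "x j \<in> {0..1}"
    by (simp add: Idom_def)
  ultimately have "x j \<in> S' P i j"
    using j by (auto simp: S'_def Sset_def)
  then show ?thesis
    using j by (auto simp: Jset_def)
qed

lemma completion_root: "feasible P y \<Longrightarrow> node_completion P Map.empty y"
  by (auto simp: node_completion_def Dnode_def feasible_iff)

lemma completion_witness:
  assumes "node_completion P p y" "i \<in> A"
  shows "\<exists>j\<in>Jnode P p i. y j \<in> S' P i j"
  using assms by (fastforce simp: node_completion_def feasible_iff Jnode_def Jset_def)

section \<open>Lower bounds\<close>

lemma continuous_on_q:
  assumes "i \<in> Rows P" "j \<in> Vars P"
  shows "continuous_on {0..1} (q P i j)"
proof -
  have a: "aplus P i j \<in> {0..1}" "aminus P i j \<in> {0..1}"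
    using assms instance_P by (auto simp: bf_mwsat_instance_def)
  have cont: "continuous_on ({0..1} \<times> {0..1}) (\<lambda>(x, y). tnorm P x y)"
    using instance_P by (simp add: bf_mwsat_instance_def continuous_t_norm_def)
  have "continuous_on {0..1} (\<lambda>z. (\<lambda>(x, y). tnorm P x y) (aplus P i j, z))"
    by (rule continuous_on_compose2[OF cont]) (use a in \<open>auto intro!: continuous_intros\<close>)
  moreover have "continuous_on {0..1} (\<lambda>z. (\<lambda>(x, y). tnorm P x y) (aminus P i j, 1 - z))"
    by (rule continuous_on_compose2[OF cont]) (use a in \<open>auto intro!: continuous_intros\<close>)
  ultimately show ?thesis
    unfolding q_def by (auto intro!: continuous_on_max)
qed

lemma closed_Idom:
  assumes "j \<in> Vars P"
  shows "closed (Idom P j)"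
proof -
  have "closed (Iset P i j)" if "i \<in> Rows P" for i
  proof -
    have "Iset P i j = {0..1} \<inter> q P i j -` {..rhs P i}"
      by (auto simp: Iset_def)
    then show ?thesis
      using continuous_closed_preimage[OF continuous_on_q[OF that assms]] by simp
  qed
  then show ?thesis
    unfolding Idom_def by (intro closed_Int closed_INT) auto
qed

lemma closed_S':
  assumes "i \<in> A" "j \<in> Vars P"
  shows "closed (S' P i j)"
proof -
  have "Sset P i j = {0..1} \<inter> q P i j -` {rhs P i}"
    by (auto simp: Sset_def)
  moreover have "i \<in> Rows P"
    using assms A_subset_Rows by blast
  ultimately have "closed (Sset P i j)"
    using continuous_closed_preimage[OF continuous_on_q[OF _ assms(2)]] by simp
  then show ?thesis
    unfolding S'_def using closed_Idom[OF assms(2)] by blast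
qed

lemma Dnode_subset_unit: "Dnode P p j \<subseteq> {0..1}"
  by (auto simp: Dnode_def Idom_def)

lemma compact_Dnode:
  assumes "valid_node P A p" "j \<in> Vars P"
  shows "compact (Dnode P p j)"
proof -
  have "closed (Dnode P p j)"
    unfolding Dnode_def
    by (intro closed_Int closed_INT)
      (use assms closed_Idom closed_S' in \<open>auto simp: valid_node_def\<close>)
  moreover have "Dnode P p j = {0..1} \<inter> Dnode P p j"
    using Dnode_subset_unit by blast
  ultimately show ?thesis
    by (metis compact_Icc compact_Int_closed)
qed

lemma compact_Dnode_S':
  assumes "valid_node P A p" "i \<in> A" "j \<in> Vars P"
  shows "compact (Dnode P p j \<inter> S' P i j)"
  using assms by (simp add: compact_Int_closed compact_Dnode closed_S')

lemma lower_point_le: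
  assumes "valid_node P A p" "node_completion P p y" "j \<in> Vars P"
  shows "lower_point P p j \<le> y j"
  using assms min_of_le[OF compact_Dnode[OF assms(1,3)], of "y j"]
  by (auto simp: lower_point_def node_completion_def)

lemma LB0_le_objective:
  assumes "valid_node P A p" "node_completion P p y"
  shows "LB0 P p \<le> objective P y"
  unfolding LB0_def objective_def
  by (intro sum_mono mult_left_mono lower_point_le[OF assms] cost_nonneg)

lemma delta_le_increment:
  assumes "valid_node P A p" "node_completion P p y" "i \<in> A" "j \<in> Jnode P p i" "y j \<in> S' P i j"
  shows "delta P p i \<le> ereal (cost P j * (y j - lower_point P p j))"
proof -
  have j: "j \<in> Vars P"
    using assms Jnode_subset_Vars by blast
  have y: "y j \<in> Dnode P p j \<inter> S' P i j"
    using assms j by (auto simp: node_completion_def)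
  let ?f = "\<lambda>j. cost P j * (min_of (Dnode P p j \<inter> S' P i j) - min_of (Dnode P p j))"
  have "Min (?f ` Jnode P p i) \<le> ?f j"
    using assms by (intro Min_le) auto
  also have "\<dots> \<le> cost P j * (y j - min_of (Dnode P p j))"
    using min_of_le[OF compact_Dnode_S'[OF assms(1,3) j] _ y] y cost_nonneg[OF j]
    by (intro mult_left_mono) auto
  finally show ?thesis
    using assms j by (auto simp: delta_def lower_point_def)
qed

text \<open>Each packed row \<open>i\<close> has a witness variable \<open>w i\<close> at which the completion pays at least
  \<open>delta P p i\<close> above the lower point. Disjointness of the witness sets makes \<open>w\<close> injective, so
  no variable's increment is charged twice.\<close>

lemma greedy_bound_le_objective:
  assumes "valid_node P A p" "node_completion P p y" "greedy_bound P A p b"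
  shows "b \<le> ereal (objective P y)"
proof -
  obtain rs K where rs: "set rs = A - dom p" and K: "K = greedy_select (Jnode P p) rs"
    and b: "b = ereal (LB0 P p) + (\<Sum>i\<in>K. delta P p i)"
    using assms(3) by (auto simp: greedy_bound_def greedy_packing_def)
  have KA: "K \<subseteq> A"
    using greedy_select_subset[of "Jnode P p" rs] rs K by auto
  obtain w where w: "\<And>i. i \<in> A \<Longrightarrow> w i \<in> Jnode P p i \<and> y (w i) \<in> S' P i (w i)"
    using completion_witness[OF assms(2)] by metis
  have inj: "inj_on w K"
  proof (rule inj_onI)
    fix i r assume ir: "i \<in> K" "r \<in> K" "w i = w r"
    then have "w i \<in> Jnode P p i \<inter> Jnode P p r"
      using w[of i] w[of r] KA by auto
    then show "i = r"
      using ir greedy_select_disjoint[of i "Jnode P p" rs r] K by blast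
  qed
  have wV: "w ` K \<subseteq> Vars P"
    using w KA Jnode_subset_Vars by blast
  let ?inc = "\<lambda>j. cost P j * (y j - lower_point P p j)"
  have "(\<Sum>i\<in>K. delta P p i) \<le> (\<Sum>i\<in>K. ereal (?inc (w i)))"
    using KA w by (intro sum_mono delta_le_increment[OF assms(1,2)]) auto
  also have "\<dots> = ereal (sum ?inc (w ` K))"
    by (simp add: sum.reindex[OF inj] sum_ereal)
  also have "\<dots> \<le> ereal (sum ?inc (Vars P))"
    using wV lower_point_le[OF assms(1,2)] cost_nonneg
    by (auto intro!: sum_mono2 mult_nonneg_nonneg)
  also have "sum ?inc (Vars P) = objective P y - LB0 P p"
    by (simp add: objective_def LB0_def right_diff_distrib sum_subtractf)
  finally have "b \<le> ereal (LB0 P p) + ereal (objective P y - LB0 P p)"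
    unfolding b by (rule add_left_mono)
  then show ?thesis
    by simp
qed

section \<open>Lower points\<close>

lemma lower_point_in_Dnode:
  assumes "valid_node P A p" "consistent P A p" "j \<in> Vars P"
  shows "lower_point P p j \<in> Dnode P p j"
  using assms min_of_in[OF compact_Dnode[OF assms(1,3)]]
  by (auto simp: consistent_def lower_point_def)

lemma lower_point_feasible:
  assumes "valid_node P A p" "consistent P A p" "satisfies_rows P (lower_point P p)"
  shows "feasible P (lower_point P p)"
proof -
  have "lower_point P p j \<in> {0..1}" if "j \<in> Vars P" for j
    using lower_point_in_Dnode[OF assms(1,2) that] Dnode_subset_unit by blast
  moreover have "lower_point P p \<in> extensional (Vars P)"
    by (simp add: lower_point_def)
  ultimately show ?thesis
    using assms(3) by (simp add: feasible_def PiE_def Pi_def)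
qed

lemma lower_point_feasible_if_all_assigned:
  assumes "valid_node P A p" "consistent P A p" "A \<subseteq> dom p"
  shows "feasible P (lower_point P p)"
  unfolding feasible_iff
proof
  show "lower_point P p \<in> Pi\<^sub>E (Vars P) (Idom P)"
    using lower_point_in_Dnode[OF assms(1,2)]
    by (auto simp: Dnode_def lower_point_def)
  show "\<forall>i\<in>A. \<exists>j\<in>Jset P i. lower_point P p j \<in> S' P i j"
  proof
    fix i assume "i \<in> A"
    then obtain j where j: "p i = Some j"
      using assms(3) by blast
    then have "j \<in> Jset P i"
      using assms(1) by (simp add: valid_node_def)
    moreover from this have "lower_point P p j \<in> Dnode P p j"
      using lower_point_in_Dnode[OF assms(1,2)] by (simp add: Jset_def)
    ultimately show "\<exists>j\<in>Jset P i. lower_point P p j \<in> S' P i j"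
      using j by (auto simp: Dnode_def)
  qed
qed

section \<open>The invariant of the search\<close>

definition incumbent_ok :: "(nat \<Rightarrow> real) option \<Rightarrow> ereal \<Rightarrow> bool" where
  "incumbent_ok x z \<longleftrightarrow>
     (case x of None \<Rightarrow> z = \<infinity> | Some y \<Rightarrow> feasible P y \<and> z = ereal (objective P y))"

definition search_inv :: "node set \<Rightarrow> (nat \<Rightarrow> real) option \<Rightarrow> ereal \<Rightarrow> bool" where
  "search_inv N x z \<longleftrightarrow>
     (\<forall>p\<in>N. valid_node P A p) \<and> incumbent_ok x z \<and>
     (\<forall>y. feasible P y \<longrightarrow> z \<le> ereal (objective P y) \<or> (\<exists>p\<in>N. node_completion P p y))"

fun bb_inv :: "bb_state \<Rightarrow> bool" where
  "bb_inv Start = True"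
| "bb_inv (Search L x z) = search_inv (set L) x z"
| "bb_inv (Process p L x z) = search_inv (insert p (set L)) x z"
| "bb_inv (Return Infeasible) = (\<nexists>y. feasible P y)"
| "bb_inv (Return (Solution x z)) = (globally_optimal P x \<and> z = ereal (objective P x))"

text \<open>Discarding, propagating and branching all replace a node \<open>p\<close> by a set \<open>M\<close> of nodes: an empty
  set, a single extension, or all children.\<close>

lemma search_inv_replace:
  assumes "search_inv (insert p N) x z"
    and "\<forall>p'\<in>M. valid_node P A p'"
    and "\<And>y. node_completion P p y \<Longrightarrow>
           z \<le> ereal (objective P y) \<or> (\<exists>p'\<in>M. node_completion P p' y)"
  shows "search_inv (M \<union> N) x z"
  using assms unfolding search_inv_def by blast

lemma search_inv_discard:
  assumes "search_inv (insert p N) x z"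
    and "\<And>y. node_completion P p y \<Longrightarrow> z \<le> ereal (objective P y)"
  shows "search_inv N x z"
  using search_inv_replace[OF assms(1), of "{}"] assms(2) by simp

lemma search_inv_assign:
  assumes "search_inv (insert p N) x z" "i \<in> A"
  shows "search_inv ((\<lambda>j. p(i \<mapsto> j)) ` Jnode P p i \<union> N) x z"
proof (rule search_inv_replace[OF assms(1)])
  show "\<forall>p'\<in>(\<lambda>j. p(i \<mapsto> j)) ` Jnode P p i. valid_node P A p'"
    using assms valid_node_update by (auto simp: search_inv_def)
  show "z \<le> ereal (objective P y) \<or>
      (\<exists>p'\<in>(\<lambda>j. p(i \<mapsto> j)) ` Jnode P p i. node_completion P p' y)" if "node_completion P p y" for y
    using completion_witness[OF that assms(2)] completion_update[OF that] by blast
qed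

lemma completion_consistent:
  assumes "node_completion P p y"
  shows "consistent P A p"
  using assms completion_witness[OF assms] by (fastforce simp: consistent_def node_completion_def)

lemma search_inv_new_incumbent:
  assumes inv: "search_inv (insert p N) x z"
    and "consistent P A p" "ereal (LB0 P p) < z" "satisfies_rows P (lower_point P p)"
  shows "search_inv N (Some (lower_point P p)) (ereal (LB0 P p))"
proof -
  have valid: "valid_node P A p"
    using inv by (simp add: search_inv_def)
  have "incumbent_ok (Some (lower_point P p)) (ereal (LB0 P p))"
    using lower_point_feasible[OF valid assms(2,4)]
    by (simp add: incumbent_ok_def LB0_def objective_def)
  moreover have "ereal (LB0 P p) \<le> ereal (objective P y) \<or> (\<exists>p'\<in>N. node_completion P p' y)"
    if y: "feasible P y" for y
  proof -
    consider "z \<le> ereal (objective P y)" | "node_completion P p y" | "\<exists>p'\<in>N. node_completion P p' y"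
      using inv y unfolding search_inv_def by blast
    then show ?thesis
    proof cases
      case 1
      then show ?thesis using assms(3) by (meson less_imp_le order_trans)
    next
      case 2
      then show ?thesis using LB0_le_objective[OF valid] by simp
    qed simp
  qed
  ultimately show ?thesis
    using inv by (simp add: search_inv_def)
qed

lemma bb_inv_step:
  assumes "bb_step P A s t" "bb_inv s"
  shows "bb_inv t"
  using assms
proof cases
  case reject
  have False if y: "feasible P y" for y
    using reject(3)
  proof
    assume "\<exists>j\<in>Vars P. Idom P j = {}"
    then show False using y by (auto simp: feasible_iff PiE_iff)
  next
    assume "\<exists>i\<in>Rows P. Jset P i = {}"
    then show False using feasible_witness[OF y] by blast
  qed
  then show ?thesis using reject by auto
next
  case initialize
  then show ?thesis
    using completion_root by (auto simp: search_inv_def incumbent_ok_def valid_node_def)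
next
  case (select L1 p L2 x z)
  then show ?thesis using assms(2) by simp
next
  case (propagate p p' L x z)
  obtain i j where "i \<in> A" "Jnode P p i = {j}" "p' = p(i \<mapsto> j)"
    using propagate(3) by (auto simp: forced_extension_def)
  then show ?thesis
    using search_inv_assign[of p "set L" x z i] propagate assms(2) by simp
next
  case (discard_inconsistent p L x z)
  then show ?thesis
    using search_inv_discard[of p "set L" x z] completion_consistent assms(2) by auto
next
  case (discard_LB0 p z L x)
  have inv: "search_inv (insert p (set L)) x z"
    using discard_LB0 assms(2) by simp
  have "z \<le> ereal (objective P y)" if "node_completion P p y" for y
    using LB0_le_objective[OF _ that] inv discard_LB0
    by (auto simp: search_inv_def intro: order_trans)
  then show ?thesis
    using search_inv_discard[OF inv] discard_LB0 by simp
next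
  case (lower_point_closure p z L x)
  then show ?thesis
    using search_inv_new_incumbent[of p "set L" x z] assms(2) by simp
next
  case (discard_greedy p z b L x)
  have inv: "search_inv (insert p (set L)) x z"
    using discard_greedy assms(2) by simp
  have "z \<le> ereal (objective P y)" if "node_completion P p y" for y
    using greedy_bound_le_objective[OF _ that discard_greedy(7)] inv discard_greedy
    by (auto simp: search_inv_def intro: order_trans)
  then show ?thesis
    using search_inv_discard[OF inv] discard_greedy by simp
next
  case (branch p z b i cs L' L x)
  have "i \<in> A" "set cs = (\<lambda>j. p(i \<mapsto> j)) ` Jnode P p i" "set L' = set cs \<union> set L"
    using branch set_shuffles[of L' L cs] by (auto simp: branching_row_def children_list_def)
  then show ?thesis
    using search_inv_assign[of p "set L" x z i] branch assms(2) by simp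
next
  case (return_incumbent x z)
  then show ?thesis
    using assms(2) by (auto simp: search_inv_def incumbent_ok_def globally_optimal_def)
next
  case (return_infeasible z)
  then show ?thesis
    using assms(2) by (auto simp: search_inv_def incumbent_ok_def)
qed

section \<open>Progress\<close>

lemma greedy_bound_exists: "\<exists>b. greedy_bound P A p b"
proof -
  obtain xs where xs: "set xs = A - dom p" "distinct xs"
    using finite_distinct_list[of "A - dom p"] by auto
  let ?rs = "sort_key (\<lambda>i. - delta P p i) xs"
  have "sorted_wrt (\<lambda>i r. delta P p r \<le> delta P p i) ?rs"
    using sorted_sort_key[of "\<lambda>i. - delta P p i" xs] by (simp add: sorted_map)
  then have "greedy_packing P A p (greedy_select (Jnode P p) ?rs)"
    unfolding greedy_packing_def using xs by (intro exI[of _ ?rs]) simp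
  then show ?thesis
    by (auto simp: greedy_bound_def)
qed

lemma children_list_exists: "\<exists>cs. children_list P A p i cs"
proof -
  obtain xs where xs: "set xs = (\<lambda>j. p(i \<mapsto> j)) ` Jnode P p i" "distinct xs"
    using finite_distinct_list[of "(\<lambda>j. p(i \<mapsto> j)) ` Jnode P p i"] by auto
  obtain B where "\<forall>c. greedy_bound P A c (B c)"
    using greedy_bound_exists by metis
  then have "children_list P A p i (sort_key B xs)"
    using xs by (auto simp: children_list_def)
  then show ?thesis ..
qed

lemma branching_row_exists:
  assumes "A - dom p \<noteq> {}"
  shows "\<exists>i. branching_row P A p i"
proof -
  let ?n = "\<lambda>i. card (Jnode P p i)"
  obtain i0 where i0: "i0 \<in> A - dom p" "\<And>r. r \<in> A - dom p \<Longrightarrow> ?n i0 \<le> ?n r"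
    using ex_is_arg_min_if_finite[of "A - dom p" ?n] assms
    by (auto simp: is_arg_min_linorder)
  let ?R = "{i \<in> A - dom p. ?n i = ?n i0}"
  have "finite ?R" "?R \<noteq> {}"
    using i0 by auto
  from ex_is_arg_min_if_finite[OF this, of "\<lambda>i. - delta P p i"]
  obtain i where i: "i \<in> ?R" "\<And>r. r \<in> ?R \<Longrightarrow> delta P p r \<le> delta P p i"
    by (auto simp: is_arg_min_linorder)
  have "branching_row P A p i"
    unfolding branching_row_def
  proof (intro conjI ballI)
    fix r assume r: "r \<in> A - dom p"
    show "?n i < ?n r \<or> ?n i = ?n r \<and> delta P p r \<le> delta P p i"
      using i0(2)[OF r] i(1) i(2)[of r] r by (cases "?n r = ?n i0") auto
  qed (use i in auto)
  then show ?thesis ..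
qed

lemma bb_step_Process:
  assumes "valid_node P A p"
  shows "\<exists>t. bb_step P A (Process p L x z) t"
proof (cases "propagated P A p \<and> consistent P A p \<and> ereal (LB0 P p) < z \<and>
    \<not> satisfies_rows P (lower_point P p)")
  case False
  then show ?thesis
    using propagate discard_inconsistent discard_LB0 lower_point_closure
    by (metis propagated_def linorder_not_less)
next
  case True
  obtain b where b: "greedy_bound P A p b"
    using greedy_bound_exists by blast
  show ?thesis
  proof (cases "b < z")
    case False
    then show ?thesis
      using discard_greedy[OF _ _ _ _ b] True by (meson linorder_not_less)
  next
    case bz: True
    have "\<not> A \<subseteq> dom p"
      using lower_point_feasible_if_all_assigned[OF assms] True by (auto simp: feasible_def)
    then obtain i cs where "branching_row P A p i" "children_list P A p i cs"
      using branching_row_exists children_list_exists by (metis Diff_eq_empty_iff)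
    moreover have "L @ cs \<in> shuffles L cs"
      by (induction L) (auto simp: Cons_in_shuffles_leftI)
    ultimately show ?thesis
      using branch[OF _ _ _ _ b bz] True by blast
  qed
qed

lemma stuck_imp_Return:
  assumes "bb_inv s" "\<nexists>t. bb_step P A s t"
  shows "\<exists>r. s = Return r"
proof (cases s)
  case Start
  then show ?thesis using assms(2) reject initialize by metis
next
  case (Search L x z)
  show ?thesis
  proof (cases L)
    case Nil
    then show ?thesis
      using Search assms(2) return_incumbent return_infeasible by (cases x) blast+
  next
    case (Cons p L2)
    then show ?thesis
      using Search assms(2) select[of P A "[]" p L2 x z] by auto
  qed
next
  case (Process p L x z)
  then show ?thesis
    using assms bb_step_Process[of p L x z] by (auto simp: search_inv_def)
next
  case (Return r)
  then show ?thesis by blast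
qed

section \<open>Termination\<close>

definition node_weight :: "node \<Rightarrow> nat" where
  "node_weight p = 2 * (nvars P + 1) ^ card (A - dom p)"

text \<open>The summand \<open>1\<close> in the case of the search list pays for the final return. A processed node
  is charged one unit less than a listed one, which makes its removal from the list a
  decrease. Every node weighs at least \<open>2\<close>, so that discarding it, which gives this unit back,
  is a decrease as well.\<close>

fun state_weight :: "bb_state \<Rightarrow> nat" where
  "state_weight Start = 2 + node_weight Map.empty"
| "state_weight (Search L x z) = 1 + sum_list (map node_weight L)"
| "state_weight (Process p L x z) = node_weight p + sum_list (map node_weight L)"
| "state_weight (Return r) = 0"

lemma node_weight_ge_2: "2 \<le> node_weight p"
  by (simp add: node_weight_def)

lemma node_weight_update:
  assumes "i \<in> A - dom p"
  shows "node_weight p = (nvars P + 1) * node_weight (p(i \<mapsto> j))"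
proof -
  have "A - dom (p(i \<mapsto> j)) = (A - dom p) - {i}"
    by auto
  then have "card (A - dom p) = Suc (card (A - dom (p(i \<mapsto> j))))"
    using card_Suc_Diff1[of "A - dom p" i] assms by simp
  then show ?thesis
    by (simp add: node_weight_def)
qed

lemma children_weight:
  assumes "i \<in> A - dom p" "children_list P A p i cs"
  shows "sum_list (map node_weight cs) + 2 \<le> node_weight p"
proof -
  \<comment> \<open>All children assign the same rows and hence have the same weight; the variable \<open>0\<close> is
    arbitrary.\<close>
  let ?w = "node_weight (p(i \<mapsto> 0))"
  have eq: "node_weight c = ?w" if "c \<in> set cs" for c
  proof -
    obtain j where "c = p(i \<mapsto> j)"
      using assms(2) \<open>c \<in> set cs\<close> by (auto simp: children_list_def)
    then show ?thesis by (simp add: node_weight_def)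
  qed
  have "length cs = card (set cs)"
    using assms(2) by (metis children_list_def distinct_card)
  also have "\<dots> \<le> card (Jnode P p i)"
    using assms(2) by (simp add: children_list_def card_image_le)
  also have "\<dots> \<le> nvars P"
    using card_mono[OF _ Jnode_subset_Vars, of P p i] by (simp add: Vars_def)
  finally have len: "length cs \<le> nvars P" .
  have "sum_list (map node_weight cs) = length cs * ?w"
    using eq by (simp add: sum_list_triv cong: map_cong)
  also have "\<dots> \<le> nvars P * ?w"
    using len by simp
  finally show ?thesis
    using node_weight_update[OF assms(1), of 0] node_weight_ge_2[of "p(i \<mapsto> 0)"] by simp
qed

lemma sum_list_shuffles:
  fixes f :: "'a \<Rightarrow> nat"
  assumes "zs \<in> shuffles xs ys"
  shows "sum_list (map f zs) = sum_list (map f xs) + sum_list (map f ys)"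
  using assms by (induction xs ys arbitrary: zs rule: shuffles.induct) auto

lemma bb_step_decreases:
  assumes "bb_step P A s t"
  shows "state_weight t < state_weight s"
  using assms
proof cases
  case (propagate p p' L x z)
  obtain i j where "i \<in> A - dom p" "p' = p(i \<mapsto> j)"
    using propagate(3) by (auto simp: forced_extension_def)
  then have "node_weight p = (nvars P + 1) * node_weight p'"
    using node_weight_update by simp
  moreover have "1 \<le> nvars P"
    using instance_P by (simp add: bf_mwsat_instance_def)
  then have "node_weight p' < (nvars P + 1) * node_weight p'"
    using node_weight_ge_2[of p'] by simp
  ultimately show ?thesis
    using propagate by simp
next
  case (discard_inconsistent p L x z)
  then show ?thesis using node_weight_ge_2[of p] by simp
next
  case (discard_LB0 p z L x)
  then show ?thesis using node_weight_ge_2[of p] by simp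
next
  case (lower_point_closure p z L x)
  then show ?thesis using node_weight_ge_2[of p] by simp
next
  case (discard_greedy p z b L x)
  then show ?thesis using node_weight_ge_2[of p] by simp
next
  case (branch p z b i cs L' L x)
  have "i \<in> A - dom p"
    using branch by (simp add: branching_row_def)
  then show ?thesis
    using branch children_weight[of i p cs] sum_list_shuffles[of L' L cs node_weight] by simp
qed auto

end

section \<open>Total correctness\<close>

theorem theorem12:
  fixes P :: bf_mwsat and A :: "nat set"
  assumes "bf_mwsat_instance P"
    and "equivalence_preserving P A"
  shows "(\<nexists>s :: nat \<Rightarrow> bb_state. s 0 = Start \<and> (\<forall>k. bb_step P A (s k) (s (Suc k)))) \<and>
    (\<forall>s. (bb_step P A)\<^sup>*\<^sup>* Start s \<and> (\<nexists>t. bb_step P A s t) \<longrightarrow>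
       ((\<exists>x. feasible P x) \<longrightarrow>
          (\<exists>x. globally_optimal P x \<and> s = Return (Solution x (ereal (objective P x))))) \<and>
       ((\<nexists>x. feasible P x) \<longrightarrow> s = Return Infeasible))"
proof -
  interpret bf_mwsat_preprocessed P A
    using assms by unfold_locales
  have "\<nexists>s. s 0 = Start \<and> (\<forall>k. bb_step P A (s k) (s (Suc k)))"
  proof
    assume "\<exists>s. s 0 = Start \<and> (\<forall>k. bb_step P A (s k) (s (Suc k)))"
    then obtain s where "\<forall>k. bb_step P A (s k) (s (Suc k))"
      by blast
    then have "\<forall>k. (s (Suc k), s k) \<in> inv_image less_than state_weight"
      using bb_step_decreases by simp
    then show False
      using wf_inv_image[OF wf_less_than, of state_weight] by (meson wf_iff_no_infinite_down_chain)
  qed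
  moreover have "((\<exists>x. feasible P x) \<longrightarrow>
        (\<exists>x. globally_optimal P x \<and> s = Return (Solution x (ereal (objective P x))))) \<and>
      ((\<nexists>x. feasible P x) \<longrightarrow> s = Return Infeasible)"
    if reach: "(bb_step P A)\<^sup>*\<^sup>* Start s" and stuck: "\<nexists>t. bb_step P A s t" for s
  proof -
    have inv: "bb_inv s"
      using reach by induction (auto intro: bb_inv_step)
    obtain r where r: "s = Return r"
      using stuck_imp_Return[OF inv stuck] by blast
    show ?thesis
      using inv r by (cases r) (auto simp: globally_optimal_def)
  qed
  ultimately show ?thesis
    by blast
qed

end
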